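(* Let $(\mathfrak h,[\cdot,\cdot]_{\mathfrak h})$ be a Leibniz algebra. Then $(\mathfrak h,\Xi(\mathfrak h),(\mathrm{ad}^L,\mathrm{ad}^R),l_2)$ is a strict Leibniz 2-algebra, where the differential $\mathfrak h\to\Xi(\mathfrak h)$ is $\alpha\mapsto(\mathrm{ad}^L_\alpha,\mathrm{ad}^R_\alpha)$ and $l_2$ is given, for $(D^L_i,D^R_i),(D^L,D^R)\in\Xi(\mathfrak h)$ and $\alpha\in\mathfrak h$, by $$l_2((D^L_1,D^R_1),(D^L_2,D^R_2))=([D^L_1,D^L_2],[D^L_1,D^R_2]),\quad l_2((D^L,D^R),\alpha)=D^L\alpha,\quad l_2(\alpha,(D^L,D^R))=D^R\alpha.$$
   Context: All vector spaces are over a fixed ground field. A (left) Leibniz algebra is a vector space with a bilinear bracket satisfying $[x,[y,z]]=[[x,y],z]+[y,[x,z]]$. The left center is $\mathrm Z(\mathfrak h)=\{\alpha\in\mathfrak h:[\alpha,\beta]_{\mathfrak h}=0\ \forall\beta\in\mathfrak h\}$. $\mathrm{ad}^L_\alpha(\beta)=[\alpha,\beta]_{\mathfrak h}$, $\mathrm{ad}^R_\alpha(\beta)=[\beta,\alpha]_{\mathfrak h}$; $[D_1,D_2]=D_1D_2-D_2D_1$ for endomorphisms. $\mathrm{Der}^L(\mathfrak h)=\{D\in\mathfrak{gl}(\mathfrak h): D[\alpha,\beta]_{\mathfrak h}=[D\alpha,\beta]_{\mathfrak h}+[\alpha,D\beta]_{\mathfrak h}\}$, $\mathrm{Der}^R(\mathfrak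 h)=\{D\in\mathfrak{gl}(\mathfrak h): D[\alpha,\beta]_{\mathfrak h}=[\alpha,D\beta]_{\mathfrak h}-[\beta,D\alpha]_{\mathfrak h}\}$, $\mathfrak{Der}(\mathfrak h)=\mathrm{Der}^L(\mathfrak h)\oplus\mathrm{Der}^R(\mathfrak h)$. $\Xi(\mathfrak h)=\{(D^L,D^R)\in\mathfrak{Der}(\mathfrak h): D^L\alpha+D^R\alpha\in\mathrm Z(\mathfrak h)\ \forall\alpha\in\mathfrak h,\text{ and }D^R\mathrm Z(\mathfrak h)=0\}$, which contains $(\mathrm{ad}^L_\alpha,\mathrm{ad}^R_\alpha)$ for all $\alpha\in\mathfrak h$. A Leibniz 2-algebra $(V_1,V_0,\mathrm d,l_2,l_3)$ consists of a linear map $\mathrm d:V_1\to V_0$, bilinear maps $l_2:V_i\times V_j\to V_{i+j}$ ($0\le i+j\le1$) and a trilinear map $l_3:V_0^3\to V_1$ such that for $w,x,y,z\in V_0$, $m,n\in V_1$: (a) $\mathrm dl_2(x,m)=l_2(x,\mathrm dm)$; (b) $\mathrm dl_2(m,x)=l_2(\mathrm dm,x)$; (c) $l_2(\mathrm dm,n)=l_2(m,\mathrm dn)$; (d) $\mathrm dl_3(x,y,z)=l_2(x,l_2(y,z))-l_2(l_2(x,y),z)-l_2(y,l_2(x,z))$; (e1) $l_3(x,y,\mathrm dm)=l_2(x,l_2(y,m))-l_2(l_2(x,y),m)-l_2(y,l_2(x,m))$; (e2) $l_3(x,\mathrm dm,y)=l_2(x,l_2(m,y))-l_2(l_2(x,m),y)-l_2(m,l_2(x,y))$;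 (e3) $l_3(\mathrm dm,x,y)=l_2(m,l_2(x,y))-l_2(l_2(m,x),y)-l_2(x,l_2(m,y))$; (f) $l_2(w,l_3(x,y,z))-l_2(x,l_3(w,y,z))+l_2(y,l_3(w,x,z))+l_2(l_3(w,x,y),z)-l_3(l_2(w,x),y,z)-l_3(x,l_2(w,y),z)-l_3(x,y,l_2(w,z))+l_3(w,l_2(x,y),z)+l_3(w,y,l_2(x,z))-l_3(w,x,l_2(y,z))=0$. It is strict if $l_3=0$; then it is denoted $(V_1,V_0,\mathrm d,l_2)$. *)

theory Defs
  imports Complex_Main "HOL-Library.Function_Algebras" "HOL-Library.Product_Plus"
begin

locale leibniz_algebra = vector_space scale
  for scale :: "'k::field \<Rightarrow> 'h::ab_group_add \<Rightarrow> 'h" +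
  fixes bracket :: "'h \<Rightarrow> 'h \<Rightarrow> 'h"
  assumes linear_bracket_right: "Vector_Spaces.linear scale scale (\<lambda>y. bracket x y)"
    and linear_bracket_left: "Vector_Spaces.linear scale scale (\<lambda>x. bracket x y)"
    and left_leibniz:
      "bracket x (bracket y z) = bracket (bracket x y) z + bracket y (bracket x z)"

definition left_center :: "('h \<Rightarrow> 'h \<Rightarrow> 'h::ab_group_add) \<Rightarrow> 'h set" where
  "left_center br = {\<alpha>. \<forall>\<beta>. br \<alpha> \<beta> = 0}"

definition adL :: "('h \<Rightarrow> 'h \<Rightarrow> 'h) \<Rightarrow> 'h \<Rightarrow> 'h \<Rightarrow> 'h" where
  "adL br \<alpha> = (\<lambda>\<beta>. br \<alpha> \<beta>)"

definition adR :: "('h \<Rightarrow> 'h \<Rightarrow> 'h) \<Rightarrow> 'h \<Rightarrow> 'h \<Rightarrow> 'h" where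
  "adR br \<alpha> = (\<lambda>\<beta>. br \<beta> \<alpha>)"

definition commutator :: "('h \<Rightarrow> 'h) \<Rightarrow> ('h \<Rightarrow> 'h) \<Rightarrow> 'h \<Rightarrow> 'h::ab_group_add" where
  "commutator D1 D2 = (D1 \<circ> D2) - (D2 \<circ> D1)"

definition DerL ::
  "('k::field \<Rightarrow> 'h::ab_group_add \<Rightarrow> 'h) \<Rightarrow> ('h \<Rightarrow> 'h \<Rightarrow> 'h) \<Rightarrow> ('h \<Rightarrow> 'h) set" where
  "DerL scale br = {D. Vector_Spaces.linear scale scale D \<and>
     (\<forall>\<alpha> \<beta>. D (br \<alpha> \<beta>) = br (D \<alpha>) \<beta> + br \<alpha> (D \<beta>))}"

definition DerR ::
  "('k::field \<Rightarrow> 'h::ab_group_add \<Rightarrow> 'h) \<Rightarrow> ('h \<Rightarrow> 'h \<Rightarrow> 'h) \<Rightarrow> ('h \<Rightarrow> 'h) set" where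
  "DerR scale br = {D. Vector_Spaces.linear scale scale D \<and>
     (\<forall>\<alpha> \<beta>. D (br \<alpha> \<beta>) = br \<alpha> (D \<beta>) - br \<beta> (D \<alpha>))}"

text \<open>The direct sum of left and right derivations is external: its elements are pairs.\<close>

definition Der ::
  "('k::field \<Rightarrow> 'h::ab_group_add \<Rightarrow> 'h) \<Rightarrow> ('h \<Rightarrow> 'h \<Rightarrow> 'h) \<Rightarrow> (('h \<Rightarrow> 'h) \<times> ('h \<Rightarrow> 'h)) set" where
  "Der scale br = DerL scale br \<times> DerR scale br"

definition Xi ::
  "('k::field \<Rightarrow> 'h::ab_group_add \<Rightarrow> 'h) \<Rightarrow> ('h \<Rightarrow> 'h \<Rightarrow> 'h) \<Rightarrow> (('h \<Rightarrow> 'h) \<times> ('h \<Rightarrow> 'h)) set" where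
  "Xi scale br = {(DL, DR). (DL, DR) \<in> Der scale br \<and>
     (\<forall>\<alpha>. DL \<alpha> + DR \<alpha> \<in> left_center br) \<and>
     (\<forall>\<alpha>\<in>left_center br. DR \<alpha> = 0)}"

text \<open>Scalar multiplication on pairs of maps; the matching addition is the pointwise and
  componentwise one of the library instances for functions and pairs.\<close>

definition scale_pair ::
  "('k \<Rightarrow> 'h \<Rightarrow> 'h) \<Rightarrow> 'k \<Rightarrow> ('h \<Rightarrow> 'h) \<times> ('h \<Rightarrow> 'h) \<Rightarrow> ('h \<Rightarrow> 'h) \<times> ('h \<Rightarrow> 'h)" where
  "scale_pair scale c = (\<lambda>(f, g). (\<lambda>x. scale c (f x), \<lambda>x. scale c (g x)))"

definition linear_on ::
  "('k \<Rightarrow> 'a::ab_group_add \<Rightarrow> 'a) \<Rightarrow> ('k \<Rightarrow> 'b::ab_group_add \<Rightarrow> 'b) \<Rightarrow>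
   'a set \<Rightarrow> 'b set \<Rightarrow> ('a \<Rightarrow> 'b) \<Rightarrow> bool" where
  "linear_on sA sB A B f \<longleftrightarrow>
     (\<forall>x\<in>A. f x \<in> B) \<and>
     (\<forall>x\<in>A. \<forall>y\<in>A. f (x + y) = f x + f y) \<and>
     (\<forall>c. \<forall>x\<in>A. f (sA c x) = sB c (f x))"

definition bilinear_on ::
  "('k \<Rightarrow> 'a::ab_group_add \<Rightarrow> 'a) \<Rightarrow> ('k \<Rightarrow> 'b::ab_group_add \<Rightarrow> 'b) \<Rightarrow>
   ('k \<Rightarrow> 'c::ab_group_add \<Rightarrow> 'c) \<Rightarrow> 'a set \<Rightarrow> 'b set \<Rightarrow> 'c set \<Rightarrow> ('a \<Rightarrow> 'b \<Rightarrow> 'c) \<Rightarrow> bool" where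
  "bilinear_on sA sB sC A B C f \<longleftrightarrow>
     (\<forall>x\<in>A. linear_on sB sC B C (\<lambda>y. f x y)) \<and>
     (\<forall>y\<in>B. linear_on sA sC A C (\<lambda>x. f x y))"

definition trilinear_on ::
  "('k \<Rightarrow> 'a::ab_group_add \<Rightarrow> 'a) \<Rightarrow> ('k \<Rightarrow> 'b::ab_group_add \<Rightarrow> 'b) \<Rightarrow>
   'a set \<Rightarrow> 'b set \<Rightarrow> ('a \<Rightarrow> 'a \<Rightarrow> 'a \<Rightarrow> 'b) \<Rightarrow> bool" where
  "trilinear_on sA sB A B f \<longleftrightarrow>
     (\<forall>x\<in>A. \<forall>y\<in>A. linear_on sA sB A B (\<lambda>z. f x y z)) \<and>
     (\<forall>x\<in>A. \<forall>z\<in>A. linear_on sA sB A B (\<lambda>y. f x y z)) \<and>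
     (\<forall>y\<in>A. \<forall>z\<in>A. linear_on sA sB A B (\<lambda>x. f x y z))"

text \<open>The spaces \<open>V1\<close> and \<open>V0\<close> are subspaces of ambient vector spaces given by types.
  The operation \<open>l\<^sub>2\<close> consists of three bilinear maps, one for each pair of degrees whose sum
  is at most 1: \<open>l00\<close> on \<open>V0 \<times> V0\<close>, \<open>l01\<close> on \<open>V0 \<times> V1\<close> and \<open>l10\<close> on \<open>V1 \<times> V0\<close>.\<close>

locale leibniz_2_algebra = S1: vector_space s1 + S0: vector_space s0
  for s1 :: "'k::field \<Rightarrow> 'a::ab_group_add \<Rightarrow> 'a"
    and s0 :: "'k \<Rightarrow> 'b::ab_group_add \<Rightarrow> 'b" +
  fixes V1 :: "'a set" and V0 :: "'b set"
    and d :: "'a \<Rightarrow> 'b"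
    and l00 :: "'b \<Rightarrow> 'b \<Rightarrow> 'b" and l01 :: "'b \<Rightarrow> 'a \<Rightarrow> 'a" and l10 :: "'a \<Rightarrow> 'b \<Rightarrow> 'a"
    and l3 :: "'b \<Rightarrow> 'b \<Rightarrow> 'b \<Rightarrow> 'a"
  assumes subspace_V1: "S1.subspace V1"
    and subspace_V0: "S0.subspace V0"
    and linear_d: "linear_on s1 s0 V1 V0 d"
    and bilinear_l00: "bilinear_on s0 s0 s0 V0 V0 V0 l00"
    and bilinear_l01: "bilinear_on s0 s1 s1 V0 V1 V1 l01"
    and bilinear_l10: "bilinear_on s1 s0 s1 V1 V0 V1 l10"
    and trilinear_l3: "trilinear_on s0 s1 V0 V1 l3"
    and ax_a: "\<lbrakk>x \<in> V0; m \<in> V1\<rbrakk> \<Longrightarrow> d (l01 x m) = l00 x (d m)"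
    and ax_b: "\<lbrakk>x \<in> V0; m \<in> V1\<rbrakk> \<Longrightarrow> d (l10 m x) = l00 (d m) x"
    and ax_c: "\<lbrakk>m \<in> V1; n \<in> V1\<rbrakk> \<Longrightarrow> l01 (d m) n = l10 m (d n)"
    and ax_d: "\<lbrakk>x \<in> V0; y \<in> V0; z \<in> V0\<rbrakk> \<Longrightarrow>
      d (l3 x y z) = l00 x (l00 y z) - l00 (l00 x y) z - l00 y (l00 x z)"
    and ax_e1: "\<lbrakk>x \<in> V0; y \<in> V0; m \<in> V1\<rbrakk> \<Longrightarrow>
      l3 x y (d m) = l01 x (l01 y m) - l01 (l00 x y) m - l01 y (l01 x m)"
    and ax_e2: "\<lbrakk>x \<in> V0; y \<in> V0; m \<in> V1\<rbrakk> \<Longrightarrow>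
      l3 x (d m) y = l01 x (l10 m y) - l10 (l01 x m) y - l10 m (l00 x y)"
    and ax_e3: "\<lbrakk>x \<in> V0; y \<in> V0; m \<in> V1\<rbrakk> \<Longrightarrow>
      l3 (d m) x y = l10 m (l00 x y) - l10 (l10 m x) y - l01 x (l10 m y)"
    and ax_f: "\<lbrakk>w \<in> V0; x \<in> V0; y \<in> V0; z \<in> V0\<rbrakk> \<Longrightarrow>
      l01 w (l3 x y z) - l01 x (l3 w y z) + l01 y (l3 w x z) + l10 (l3 w x y) z
      - l3 (l00 w x) y z - l3 x (l00 w y) z - l3 x y (l00 w z)
      + l3 w (l00 x y) z + l3 w y (l00 x z) - l3 w x (l00 y z) = 0"

definition strict_leibniz_2_algebra ::
  "('k::field \<Rightarrow> 'a::ab_group_add \<Rightarrow> 'a) \<Rightarrow> ('k \<Rightarrow> 'b::ab_group_add \<Rightarrow> 'b) \<Rightarrow> 'a set \<Rightarrow> 'b set \<Rightarrow>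
   ('a \<Rightarrow> 'b) \<Rightarrow> ('b \<Rightarrow> 'b \<Rightarrow> 'b) \<Rightarrow> ('b \<Rightarrow> 'a \<Rightarrow> 'a) \<Rightarrow> ('a \<Rightarrow> 'b \<Rightarrow> 'a) \<Rightarrow> bool" where
  "strict_leibniz_2_algebra s1 s0 V1 V0 d l00 l01 l10 \<longleftrightarrow>
     leibniz_2_algebra s1 s0 V1 V0 d l00 l01 l10 (\<lambda>_ _ _. 0)"

end

theory Submission imports Defs begin

text \<open>
  An element of \<open>\<Xi>(\<hh>)\<close> is a pair \<open>(D\<^sup>L, D\<^sup>R)\<close> that acts on \<open>\<hh>\<close> from both sides as if
  by left and right multiplication. The differential replaces \<open>\<alpha>\<close> by its own
  multiplications, so two elements of \<open>\<hh>\<close> always combine to \<open>[\<alpha>, \<beta>]\<close>, and the other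
  nontrivial axioms of a strict Leibniz 2-algebra are identities of three kinds.

  The Leibniz identities with three arguments from \<open>\<Xi>(\<hh>)\<close>, or with one argument from
  \<open>\<hh>\<close> in second or third place, hold for all additive maps: they say that \<open>[D, _]\<close> is a
  derivation of the commutator, or spell out a commutator at an element.

  Those saying that the differential is equivariant are, with one exception, the
  derivation rules read off at \<open>\<alpha>\<close>: the rule for \<open>D\<^sup>L\<close> is \<open>[D\<^sup>L, ad\<^sup>L\<^sub>\<alpha>] = ad\<^sup>L\<^bsub>D\<^sup>L \<alpha>\<^esub>\<close> and also
  \<open>[D\<^sup>L, ad\<^sup>R\<^sub>\<alpha>] = ad\<^sup>R\<^bsub>D\<^sup>L \<alpha>\<^esub>\<close>, and the rule for \<open>D\<^sup>R\<close> is
  \<open>[ad\<^sup>L\<^sub>\<alpha>, D\<^sup>R] = ad\<^sup>R\<^bsub>D\<^sup>R \<alpha>\<^esub>\<close>.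

  The rest compare \<open>D\<^sup>L\<close> with \<open>- D\<^sup>R\<close>, and this is where the two conditions that cut
  \<open>\<Xi>(\<hh>)\<close> out of \<open>\<DD>er(\<hh>)\<close> enter. Since \<open>D\<^sup>L + D\<^sup>R\<close> takes values in the left center,
  \<open>[D\<^sup>L \<alpha>, \<beta>] = - [D\<^sup>R \<alpha>, \<beta>]\<close>, which gives the exceptional
  equivariance rule \<open>[ad\<^sup>L\<^sub>\<alpha>, D\<^sup>L] = ad\<^sup>L\<^bsub>D\<^sup>R \<alpha>\<^esub>\<close>; since right
  components kill the left center, \<open>D\<^sub>2\<^sup>R D\<^sub>1\<^sup>L = - D\<^sub>2\<^sup>R D\<^sub>1\<^sup>R\<close>, which is the last compatibility of \<open>l\<^sub>2\<close>.

  That \<open>l\<^sub>2\<close> does not leave \<open>\<Xi>(\<hh>)\<close> rests on left derivations preserving the left center.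
\<close>

lemma left_center_iff: "\<alpha> \<in> left_center br \<longleftrightarrow> (\<forall>\<beta>. br \<alpha> \<beta> = 0)"
  by (simp add: left_center_def)

lemma commutator_jacobi:
  assumes "\<And>x y. A (x - y) = A x - A y" "\<And>x y. B (x - y) = B x - B y"
    and "\<And>x y. C (x - y) = C x - C y"
  shows "commutator A (commutator B C) =
    commutator (commutator A B) C + commutator B (commutator A C)"
  by (simp add: commutator_def fun_eq_iff assms)

lemma vector_space_scale_pair:
  assumes "vector_space scale"
  shows "vector_space (scale_pair scale)"
proof -
  interpret vector_space scale by fact
  show ?thesis
    by unfold_locales
      (auto simp: scale_pair_def fun_eq_iff scale_right_distrib scale_left_distrib)
qed

context leibniz_algebra
begin

lemma bracket_add_left: "bracket (x + y) z = bracket x z + bracket y z"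
  and bracket_scale_left: "bracket (scale c x) z = scale c (bracket x z)"
  using linear_bracket_left[of z] by (auto simp: Vector_Spaces.linear_iff)

lemma bracket_add_right: "bracket x (y + z) = bracket x y + bracket x z"
  and bracket_scale_right: "bracket x (scale c z) = scale c (bracket x z)"
  using linear_bracket_right[of x] by (auto simp: Vector_Spaces.linear_iff)

lemma bracket_zero_right [simp]: "bracket x 0 = 0"
  using bracket_add_right[of x 0 0] by simp

lemma bracket_zero_left [simp]: "bracket 0 x = 0"
  using bracket_add_left[of 0 0 x] by simp

lemma bracket_diff_right: "bracket x (y - z) = bracket x y - bracket x z"
  using bracket_add_right[of x "y - z" z] by simp

lemma bracket_diff_left: "bracket (y - z) x = bracket y x - bracket z x"
  using bracket_add_left[of "y - z" z x] by simp

lemma Xi_iff: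
  "(DL, DR) \<in> Xi scale bracket \<longleftrightarrow>
     (\<forall>x y. DL (x + y) = DL x + DL y) \<and> (\<forall>c x. DL (scale c x) = scale c (DL x)) \<and>
     (\<forall>x y. DR (x + y) = DR x + DR y) \<and> (\<forall>c x. DR (scale c x) = scale c (DR x)) \<and>
     (\<forall>x y. DL (bracket x y) = bracket (DL x) y + bracket x (DL y)) \<and>
     (\<forall>x y. DR (bracket x y) = bracket x (DR y) - bracket y (DR x)) \<and>
     (\<forall>x y. bracket (DL x) y + bracket (DR x) y = 0) \<and>
     (\<forall>x\<in>left_center bracket. DR x = 0)"
  by (auto simp: Xi_def Der_def DerL_def DerR_def Vector_Spaces.linear_iff left_center_iff
      bracket_add_left vector_space_axioms)

lemma XiD:
  assumes "(DL, DR) \<in> Xi scale bracket"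
  shows Xi_left_add: "DL (x + y) = DL x + DL y"
    and Xi_left_diff: "DL (x - y) = DL x - DL y"
    and Xi_left_scale: "DL (scale c x) = scale c (DL x)"
    and Xi_right_add: "DR (x + y) = DR x + DR y"
    and Xi_right_diff: "DR (x - y) = DR x - DR y"
    and Xi_right_scale: "DR (scale c x) = scale c (DR x)"
    and Xi_left_derivation: "DL (bracket x y) = bracket (DL x) y + bracket x (DL y)"
    and Xi_right_derivation: "DR (bracket x y) = bracket x (DR y) - bracket y (DR x)"
    and Xi_bracket_right: "bracket (DR x) y = - bracket (DL x) y"
    and Xi_right_left_center: "z \<in> left_center bracket \<Longrightarrow> DR z = 0"
proof -
  note X = assms[unfolded Xi_iff]
  show addL: "DL (x + y) = DL x + DL y" and addR: "DR (x + y) = DR x + DR y" for x y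
    using X by auto
  show "DL (x - y) = DL x - DL y" "DR (x - y) = DR x - DR y"
    using addL[of "x - y" y] addR[of "x - y" y] by auto
  show "bracket (DR x) y = - bracket (DL x) y"
    using X by (simp add: eq_neg_iff_add_eq_0 add.commute)
qed (use assms[unfolded Xi_iff] in auto)

lemma Xi_zero:
  assumes "(DL, DR) \<in> Xi scale bracket"
  shows "DL 0 = 0" "DR 0 = 0"
  using Xi_left_diff[OF assms, of 0 0] Xi_right_diff[OF assms, of 0 0] by auto

lemma Xi_sum_in_left_center:
  assumes "(DL, DR) \<in> Xi scale bracket"
  shows "DL x + DR x \<in> left_center bracket"
  by (simp add: left_center_iff bracket_add_left Xi_bracket_right[OF assms])

text \<open>Both conditions on the left center meet here: the sum of the components of the first
  pair lands in the left center, and the right component of the second pair kills it.\<close>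

lemma Xi_right_comp_left:
  assumes "(DL, DR) \<in> Xi scale bracket" "(EL, ER) \<in> Xi scale bracket"
  shows "ER (DL x) = - ER (DR x)"
  using Xi_right_left_center[OF assms(2) Xi_sum_in_left_center[OF assms(1), of x]]
  by (simp add: Xi_right_add[OF assms(2)] eq_neg_iff_add_eq_0)

text \<open>For \<open>\<alpha>\<close> in the left center, write the derivation rule as
  \<open>[D\<^sup>L \<alpha>, \<beta>] = D\<^sup>L [\<alpha>, \<beta>] - [\<alpha>, D\<^sup>L \<beta>]\<close>: both terms vanish.\<close>

lemma Xi_left_preserves_left_center:
  assumes "(DL, DR) \<in> Xi scale bracket" "z \<in> left_center bracket"
  shows "DL z \<in> left_center bracket"
  using assms(2) Xi_left_derivation[OF assms(1), of z]
  by (simp add: left_center_iff Xi_zero[OF assms(1)])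

text \<open>The sum of the components of \<open>([D\<^sub>1\<^sup>L, D\<^sub>2\<^sup>L], [D\<^sub>1\<^sup>L, D\<^sub>2\<^sup>R])\<close> is
  \<open>[D\<^sub>1\<^sup>L, D\<^sub>2\<^sup>L + D\<^sub>2\<^sup>R]\<close>, which takes values in the left center because both
  \<open>D\<^sub>2\<^sup>L + D\<^sub>2\<^sup>R\<close> does and \<open>D\<^sub>1\<^sup>L\<close> preserves it.\<close>

lemma commutator_in_Xi:
  assumes D: "(DL, DR) \<in> Xi scale bracket" and E: "(EL, ER) \<in> Xi scale bracket"
  shows "(commutator DL EL, commutator DL ER) \<in> Xi scale bracket"
proof -
  note simps = XiD[OF D] XiD[OF E] scale_right_diff_distrib bracket_add_right
    bracket_add_left bracket_diff_left bracket_diff_right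
  have "bracket (DL (EL x + ER x)) y = 0" for x y
    using Xi_left_preserves_left_center[OF D Xi_sum_in_left_center[OF E]]
    by (simp add: left_center_iff)
  then have *: "bracket (DL (ER x)) y = - bracket (DL (EL x)) y" for x y
    by (simp add: Xi_left_add[OF D] bracket_add_left eq_neg_iff_add_eq_0 add.commute)
  show ?thesis
    unfolding Xi_iff
    by (auto simp: commutator_def simps * Xi_zero[OF D]
        Xi_left_preserves_left_center[OF D])
qed

text \<open>The derivation rules are forms of the left Leibniz identity. Solved for \<open>[[x, y], z]\<close>, it shows that
  \<open>ad\<^sup>R\<^sub>z\<close> is a right derivation; its right-hand side is then antisymmetric in \<open>x\<close> and \<open>y\<close>,
  which puts \<open>[x, y] + [y, x]\<close> into the left center.\<close>

lemma ad_in_Xi: "(adL bracket \<alpha>, adR bracket \<alpha>) \<in> Xi scale bracket"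
proof -
  have *: "bracket (bracket x y) z = bracket x (bracket y z) - bracket y (bracket x z)" for x y z
    using left_leibniz[of x y z] by simp
  show ?thesis
    unfolding Xi_iff
    by (auto simp: adL_def adR_def * bracket_add_left bracket_add_right
        bracket_scale_left bracket_scale_right left_center_iff)
qed

lemma ad_zero: "adL bracket 0 = 0" "adR bracket 0 = 0"
  by (auto simp: adL_def adR_def)

lemma subspace_Xi: "module.subspace (scale_pair scale) (Xi scale bracket)"
proof -
  interpret P: vector_space "scale_pair scale"
    by (rule vector_space_scale_pair) unfold_locales
  show ?thesis
  proof (rule P.subspaceI)
    show "0 \<in> Xi scale bracket"
      by (simp add: zero_prod_def Xi_iff)
  next
    fix p q assume pq: "p \<in> Xi scale bracket" "q \<in> Xi scale bracket"
    obtain DL DR EL ER where "p = (DL, DR)" "q = (EL, ER)"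
      by (cases p, cases q)
    with pq have D: "(DL, DR) \<in> Xi scale bracket" and E: "(EL, ER) \<in> Xi scale bracket"
      by auto
    show "p + q \<in> Xi scale bracket"
      unfolding \<open>p = _\<close> \<open>q = _\<close> add_Pair Xi_iff
      by (auto simp: XiD[OF D] XiD[OF E] bracket_add_left bracket_add_right
          scale_right_distrib)
  next
    fix c p assume "p \<in> Xi scale bracket"
    then obtain DL DR where p: "p = (DL, DR)" and D: "(DL, DR) \<in> Xi scale bracket"
      by (cases p) auto
    show "scale_pair scale c p \<in> Xi scale bracket"
      unfolding p scale_pair_def prod.case Xi_iff
      by (auto simp: XiD[OF D] bracket_scale_left bracket_scale_right
          scale_right_distrib scale_right_diff_distrib scale_left_commute)
  qed
qed

text \<open>The first two equations say that the differential commutes with the left action of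
  \<open>\<Xi>(\<hh>)\<close>, the last two that it commutes with the right action. In the third,
  a left component acts and a right component comes out: the derivation rule yields
  \<open>- [D\<^sup>L \<alpha>, \<beta>]\<close>, which is \<open>[D\<^sup>R \<alpha>, \<beta>]\<close> because \<open>D\<^sup>L \<alpha> + D\<^sup>R \<alpha>\<close> is in the
  left center.\<close>

lemma commutator_ad:
  assumes "(DL, DR) \<in> Xi scale bracket"
  shows "commutator DL (adL bracket \<alpha>) = adL bracket (DL \<alpha>)"
    and "commutator DL (adR bracket \<alpha>) = adR bracket (DL \<alpha>)"
    and "commutator (adL bracket \<alpha>) DL = adL bracket (DR \<alpha>)"
    and "commutator (adL bracket \<alpha>) DR = adR bracket (DR \<alpha>)"
  by (auto simp: commutator_def adL_def adR_def fun_eq_iff XiD[OF assms])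

lemma bilinear_commutator_pair:
  "bilinear_on (scale_pair scale) (scale_pair scale) (scale_pair scale)
     (Xi scale bracket) (Xi scale bracket) (Xi scale bracket)
     (\<lambda>(D1L, D1R) (D2L, D2R). (commutator D1L D2L, commutator D1L D2R))"
  unfolding bilinear_on_def linear_on_def
  by (auto simp: commutator_in_Xi[unfolded commutator_def] scale_pair_def fun_eq_iff commutator_def XiD
      scale_right_diff_distrib)

end

theorem proposition3p11:
  fixes scale :: "'k::field \<Rightarrow> 'h::ab_group_add \<Rightarrow> 'h"
    and bracket :: "'h \<Rightarrow> 'h \<Rightarrow> 'h"
  assumes "leibniz_algebra scale bracket"
  shows "strict_leibniz_2_algebra scale (scale_pair scale) UNIV (Xi scale bracket)
    (\<lambda>\<alpha>. (adL bracket \<alpha>, adR bracket \<alpha>))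
    (\<lambda>(D1L, D1R) (D2L, D2R). (commutator D1L D2L, commutator D1L D2R))
    (\<lambda>(DL, DR) \<alpha>. DL \<alpha>)
    (\<lambda>\<alpha> (DL, DR). DR \<alpha>)"
proof -
  interpret leibniz_algebra scale bracket by fact
  interpret P: vector_space "scale_pair scale"
    by (rule vector_space_scale_pair) unfold_locales
  show ?thesis
    unfolding strict_leibniz_2_algebra_def
  proof (unfold_locales, goal_cases)
    case 1
    show ?case by simp
  next
    case 2
    show ?case by (rule subspace_Xi)
  next
    case 3
    show ?case
      by (auto simp: linear_on_def ad_in_Xi[unfolded adL_def adR_def] scale_pair_def adL_def adR_def fun_eq_iff
          bracket_add_left bracket_add_right bracket_scale_left bracket_scale_right)
  next
    case 4
    show ?case by (rule bilinear_commutator_pair)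
  next
    case 5
    show ?case
      by (auto simp: bilinear_on_def linear_on_def scale_pair_def XiD)
  next
    case 6
    show ?case
      by (auto simp: bilinear_on_def linear_on_def scale_pair_def XiD)
  next
    case 7
    show ?case by (auto simp: trilinear_on_def linear_on_def P.subspace_0 subspace_Xi)
  next
    case (8 x m)
    then show ?case by (cases x) (simp add: commutator_ad)
  next
    case (9 x m)
    then show ?case by (cases x) (simp add: commutator_ad)
  next
    case (10 m n)
    show ?case by (simp add: adL_def adR_def)
  next
    case (11 x y z)
    \<comment> \<open>Each component is a Jacobi identity; only the innermost map of the triple is a left
      component in one case and a right component in the other.\<close>
    then obtain D D' E E' F F' where "x = (D, D')" "y = (E, E')" "z = (F, F')"
      and "(D, D') \<in> Xi scale bracket" "(E, E') \<in> Xi scale bracket"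
        "(F, F') \<in> Xi scale bracket"
      by (cases x, cases y, cases z) auto
    then show ?case
      by (simp add: zero_prod_def ad_zero
          commutator_jacobi[of D E F] commutator_jacobi[of D E F'] Xi_left_diff Xi_right_diff)
  next
    case (12 x y m)
    then show ?case by (cases x; cases y) (simp add: commutator_def)
  next
    case (13 x y m)
    then show ?case by (cases x; cases y) (simp add: commutator_def)
  next
    case (14 x y m)
    \<comment> \<open>Once the commutator is expanded, what is left is that the right component of \<open>y\<close>
      kills the sum of the components of \<open>x\<close>.\<close>
    then show ?case by (cases x; cases y) (simp add: commutator_def Xi_right_comp_left)
  next
    case (15 w x y z)
    then show ?case by (cases w; cases x; cases y; cases z) (simp add: Xi_zero)
  qed
qed

end
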